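(* As formal power series, $$\sum_{i, j\geq 0}\frac{x^iy^{i+2j}q^{2i^2+4j^2+4ij-i}}{(q^2; q^2)_i(q^4; q^4)_j}=\sum_{i, j\geq 0}\frac{(-1)^j(x; q^2)_jy^{i+j}q^{i^2+j^2+2ij}}{(q^2; q^2)_i(q^2; q^2)_j}.$$
   Context: $(a;q)_n=(1-a)(1-aq)\cdots(1-aq^{n-1})$ for $n\ge1$, $(a;q)_0=1$. *)

theory Defs
  imports "HOL-Analysis.Infinite_Sum" "HOL-Computational_Algebra.Formal_Power_Series"
begin

unbundle fps_syntax

definition qpoch :: "'a::comm_ring_1 \<Rightarrow> 'a \<Rightarrow> nat \<Rightarrow> 'a" where
  "qpoch a q n = (\<Prod>k<n. 1 - a * q ^ k)"

text \<open>
  The ring of formal power series in \<open>x\<close>, \<open>y\<close>, \<open>q\<close> over a field \<open>k\<close> is represented as the iterated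
  power series ring \<open>k[[q]][[x]][[y]]\<close>: the outermost layer is \<open>y\<close>, the innermost one is \<open>q\<close>.

  The library topology on this type is the \<open>y\<close>-adic one. It is finer than both the \<open>(x,y,q)\<close>-adic
  topology and that of coefficientwise convergence in \<open>x\<close>, \<open>y\<close>, \<open>q\<close>, so a family that is summable
  in it is summable in these as well, with the same sum.

  Exponents of \<open>q\<close> are natural numbers. Since \<open>i \<le> 2 * i\<^sup>2\<close>, the subtraction in
  \<open>2 * i\<^sup>2 + 4 * j\<^sup>2 + 4 * i * j - i\<close> never truncates.
\<close>

type_synonym 'a fps3 = "'a fps fps fps"

definition var_q :: "'a::field fps3" where
  "var_q = fps_const (fps_const fps_X)"

definition var_x :: "'a::field fps3" where
  "var_x = fps_const fps_X"

definition var_y :: "'a::field fps3" where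
  "var_y = fps_X"

text \<open>
  The coefficients of the two outer layers form no field, so the following lemmas record that
  division by a power series in \<open>x\<close>, \<open>y\<close>, \<open>q\<close> with nonzero constant coefficient, in particular by
  \<open>(q\<^sup>m; q\<^sup>m)\<^sub>n\<close> with \<open>m > 0\<close>, is genuine division.
\<close>

lemma fps_inverse_mult_unit:
  fixes f :: "'b::{comm_ring_1,inverse} fps"
  assumes "inverse (f $ 0) * f $ 0 = 1"
  shows "inverse f * f = 1"
  using fps_right_inverse[of f "inverse (f $ 0)"] assms by (simp add: fps_inverse_def mult.commute)

lemma fps3_divide_mult_unit:
  fixes f g :: "'a::field fps3"
  assumes "g $ 0 $ 0 $ 0 \<noteq> 0"
  shows "f / g * g = f"
proof -
  have "inverse g * g = 1"
    using assms by (intro fps_inverse_mult_unit) simp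
  moreover have "g $ 0 \<noteq> 0"
    using assms by auto
  ultimately show ?thesis
    by (simp add: fps_divide_def subdegree_eq_0 mult.assoc)
qed

lemma qpoch_var_q_nth_0:
  assumes "m > 0"
  shows "qpoch (var_q ^ m) (var_q ^ m) n $ 0 $ 0 $ 0 = (1::'a::field)"
  using assms
  by (induction n) (simp_all add: qpoch_def var_q_def fps_power_zeroth zero_power)

end

theory Submission
  imports Defs
begin

text \<open>
  Write \<open>Q = q\<^sup>2\<close> and \<open>n\<close> for the exponent of \<open>y\<close>. Since
  \<open>2i\<^sup>2 + 4j\<^sup>2 + 4ij - i = (i + 2j)\<^sup>2 + i(i - 1)\<close>, the coefficients of \<open>y\<^sup>n\<close> on both sides carry the
  factor \<open>q\<close> to the power \<open>n\<^sup>2\<close>. After removing it, both sides are products of two power series in an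
  auxiliary variable \<open>t\<close>, namely \<open>(-xt; Q)\<^sub>\<infinity> \<sqdot> 1/(t\<^sup>2; Q\<^sup>2)\<^sub>\<infinity>\<close> on the left and
  \<open>1/(t; Q)\<^sub>\<infinity> \<sqdot> (-xt; Q)\<^sub>\<infinity>/(-t; Q)\<^sub>\<infinity>\<close> on the right. Both satisfy
  \<open>(1 - t\<^sup>2) F(t) = (1 + xt) F(Qt)\<close>, which determines \<open>F\<close> from its constant coefficient.
\<close>

section \<open>The substitution of \<open>c * t\<close> for \<open>t\<close>, and uniqueness for
  dilation equations\<close>

definition fps_dilate :: "'b::comm_ring_1 \<Rightarrow> 'b fps \<Rightarrow> 'b fps" where
  "fps_dilate c f = f oo (fps_const c * fps_X)"

lemma fps_dilate_nth [simp]: "fps_dilate c f $ n = c ^ n * f $ n"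
  by (simp add: fps_dilate_def fps_compose_linear)

lemma fps_dilate_mult:
  fixes f g :: "'b::idom fps"
  shows "fps_dilate c (f * g) = fps_dilate c f * fps_dilate c g"
  by (simp add: fps_dilate_def fps_compose_mult_distrib)

lemma fps_mult_nth_eq_of_vanishing_below:
  fixes f g :: "'b::comm_ring_1 fps"
  assumes "\<And>k. k < n \<Longrightarrow> g $ k = 0"
  shows "(f * g) $ n = f $ 0 * g $ n"
proof -
  have "(f * g) $ n = (\<Sum>k=0..n. f $ k * g $ (n - k))"
    by (simp add: fps_mult_nth)
  also have "\<dots> = (\<Sum>k\<in>{0}. f $ k * g $ (n - k))"
    by (rule sum.mono_neutral_right) (auto simp: assms)
  finally show ?thesis by simp
qed

text \<open>For the difference \<open>h\<close> of two solutions, once all lower coefficients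
  vanish, the equation in degree \<open>n\<close> reduces to \<open>h $ n = c ^ n * h $ n\<close>.
  As \<open>c ^ n \<noteq> 1\<close> for \<open>n > 0\<close>, strong induction kills every
  coefficient.\<close>

lemma fps_dilate_equation_unique:
  fixes f g u v :: "'b::idom fps"
  assumes c: "\<And>n. n > 0 \<Longrightarrow> c ^ n \<noteq> 1"
    and uv: "u $ 0 = 1" "v $ 0 = 1"
    and f: "u * f = v * fps_dilate c f"
    and g: "u * g = v * fps_dilate c g"
    and fg: "f $ 0 = g $ 0"
  shows "f = g"
proof (rule fps_ext)
  define h where "h = f - g"
  have h: "u * h = v * fps_dilate c h"
  proof -
    have "fps_dilate c h = fps_dilate c f - fps_dilate c g"
      by (rule fps_ext) (simp add: h_def algebra_simps)
    then show ?thesis using f g by (simp add: h_def right_diff_distrib)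
  qed
  have "h $ n = 0" for n
  proof (induction n rule: less_induct)
    case (less n)
    have "(u * h) $ n = h $ n" "(v * fps_dilate c h) $ n = c ^ n * h $ n"
      by (simp_all add: fps_mult_nth_eq_of_vanishing_below less uv)
    then have "(c ^ n - 1) * h $ n = 0"
      using h by (simp add: algebra_simps)
    moreover have "h $ 0 = 0" by (simp add: h_def fg)
    ultimately show ?case using c[of n] by (cases "n = 0") auto
  qed
  then show "f $ n = g $ n" for n by (simp add: h_def)
qed

section \<open>q-Pochhammer symbols and the identity in the auxiliary variable\<close>

lemma qpoch_0 [simp]: "qpoch a q 0 = 1"
  by (simp add: qpoch_def)

lemma qpoch_Suc: "qpoch a q (Suc n) = qpoch a q n * (1 - a * q ^ n)"
  by (simp add: qpoch_def)

lemma qpoch_fps_const: "qpoch (fps_const a) (fps_const b) n = fps_const (qpoch a b n)"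
  by (induction n) (simp_all add: qpoch_Suc fps_const_mult[symmetric] fps_const_sub[symmetric]
      fps_const_power del: fps_const_mult fps_const_sub)

text \<open>
  The coefficient of \<open>t\<^sup>n\<close> in
  \<open>(-xt; Q)\<^sub>\<infinity> \<sqdot> 1/(t\<^sup>2; Q\<^sup>2)\<^sub>\<infinity> = 1/(t; Q)\<^sub>\<infinity> \<sqdot> (-xt; Q)\<^sub>\<infinity>/(-t; Q)\<^sub>\<infinity>\<close>.
\<close>
lemma qseries_coefficient_identity:
  fixes q x :: "'b::idom" and e e' :: "nat \<Rightarrow> 'b"
  assumes q: "\<And>n. n > 0 \<Longrightarrow> q ^ n \<noteq> 1"
    and e: "\<And>n. e n * qpoch (q\<^sup>2) (q\<^sup>2) n = 1"
    and e': "\<And>n. e' n * qpoch (q ^ 4) (q ^ 4) n = 1"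
  shows "(\<Sum>(i, j) | i + 2 * j = n. x ^ i * q ^ (i * (i - 1)) * e i * e' j) =
         (\<Sum>(i, j) | i + j = n. e i * ((- 1) ^ j * qpoch x (q\<^sup>2) j * e j))"
proof -
  \<comment> \<open>By the expansions of Euler and the q-binomial theorem, with Q =
    \<open>q\<^sup>2\<close>, \<open>A\<close> is 1/(t; Q)_inf, \<open>B\<close> is (-xt;
    Q)_inf/(-t; Q)_inf, \<open>C\<close> is (-xt; Q)_inf and \<open>D\<close> is 1/(t^2; Q^2)_inf.
    Only the coefficients are used, so no infinite product has to be formed.\<close>
  define A where "A = Abs_fps e"
  define B where "B = Abs_fps (\<lambda>n. (- 1) ^ n * qpoch x (q\<^sup>2) n * e n)"
  define C where "C = Abs_fps (\<lambda>n. x ^ n * q ^ (n * (n - 1)) * e n)"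
  define D where "D = Abs_fps (\<lambda>n. if even n then e' (n div 2) else 0)"
  let ?dil = "fps_dilate (q\<^sup>2)"
  have e_Suc: "(1 - (q\<^sup>2) ^ Suc n) * e (Suc n) = e n" for n
  proof -
    have "e n * 1 = e n * (e (Suc n) * (qpoch (q\<^sup>2) (q\<^sup>2) n * (1 - (q\<^sup>2) ^ Suc n)))"
      using e[of "Suc n"] by (simp add: qpoch_Suc)
    also have "\<dots> = (e n * qpoch (q\<^sup>2) (q\<^sup>2) n) * ((1 - (q\<^sup>2) ^ Suc n) * e (Suc n))"
      by (simp only: mult_ac)
    finally show ?thesis by (simp add: e)
  qed
  have e'_Suc: "(1 - (q ^ 4) ^ Suc n) * e' (Suc n) = e' n" for n
  proof -
    have "e' n * 1 = e' n * (e' (Suc n) * (qpoch (q ^ 4) (q ^ 4) n * (1 - (q ^ 4) ^ Suc n)))"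
      using e'[of "Suc n"] by (simp add: qpoch_Suc)
    also have "\<dots> = (e' n * qpoch (q ^ 4) (q ^ 4) n) * ((1 - (q ^ 4) ^ Suc n) * e' (Suc n))"
      by (simp only: mult_ac)
    finally show ?thesis by (simp add: e')
  qed
  have e0: "e 0 = 1" "e' 0 = 1" using e[of 0] e'[of 0] by simp_all
  \<comment> \<open>Replacing t by Qt drops the first factor of each infinite product. On
    coefficients, the four resulting equations are recurrences that come from \<open>e_Suc\<close>
    and, for \<open>D\<close>, from \<open>e'_Suc\<close>.\<close>
  have A: "?dil A = (1 - fps_X) * A"
  proof (rule fps_ext)
    show "?dil A $ n = ((1 - fps_X) * A) $ n" for n
    proof (cases n)
      case (Suc m)
      then show ?thesis using e_Suc[of m] by (simp add: A_def left_diff_distrib algebra_simps)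
    qed (simp add: A_def)
  qed
  have B: "(1 + fps_X) * B = (1 + fps_const x * fps_X) * ?dil B"
  proof (rule fps_ext)
    show "((1 + fps_X) * B) $ n = ((1 + fps_const x * fps_X) * ?dil B) $ n" for n
    proof (cases n)
      case (Suc m)
      let ?s = "(- 1) ^ m * qpoch x (q\<^sup>2) m"
      have "B $ Suc m - (q\<^sup>2) ^ Suc m * B $ Suc m
          = - (?s * (1 - x * (q\<^sup>2) ^ m) * ((1 - (q\<^sup>2) ^ Suc m) * e (Suc m)))"
        by (simp add: B_def qpoch_Suc algebra_simps)
      also have "\<dots> = - ((1 - x * (q\<^sup>2) ^ m) * B $ m)"
        by (simp only: e_Suc) (simp add: B_def algebra_simps)
      finally show ?thesis using Suc by (simp add: distrib_right mult.assoc) (simp add: algebra_simps)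
    qed (simp add: B_def)
  qed
  have C: "C = (1 + fps_const x * fps_X) * ?dil C"
  proof (rule fps_ext)
    show "C $ n = ((1 + fps_const x * fps_X) * ?dil C) $ n" for n
    proof (cases n)
      case (Suc m)
      have exp: "q ^ (Suc m * m) = (q\<^sup>2) ^ m * q ^ (m * (m - 1))"
      proof -
        have "Suc m * m = 2 * m + m * (m - 1)" by (cases m) simp_all
        then have "q ^ (Suc m * m) = q ^ (2 * m + m * (m - 1))" by (rule arg_cong)
        then show ?thesis unfolding power_add power_mult[of q 2] .
      qed
      have "C $ Suc m - (q\<^sup>2) ^ Suc m * C $ Suc m
          = x ^ Suc m * q ^ (Suc m * m) * ((1 - (q\<^sup>2) ^ Suc m) * e (Suc m))"
        by (simp add: C_def algebra_simps)
      also have "\<dots> = x * ((q\<^sup>2) ^ m * C $ m)"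
        unfolding e_Suc exp by (simp add: C_def algebra_simps)
      finally show ?thesis using Suc by (simp add: distrib_right mult.assoc) (simp add: algebra_simps)
    qed (simp add: C_def)
  qed
  have D: "?dil D = (1 - fps_X\<^sup>2) * D"
  proof (rule fps_ext)
    show "?dil D $ n = ((1 - fps_X\<^sup>2) * D) $ n" for n
    \<comment> \<open>Multiplication by t^2 shifts by two places, so degrees 0 and 1 are the base
      cases. Above them odd degrees give 0 = 0, and degree \<open>2 * k + 2\<close> is
      \<open>e'_Suc\<close> at \<open>k\<close>.\<close>
    proof (cases "n < 2")
      case True
      then have "n = 0 \<or> n = 1" by auto
      then show ?thesis by (auto simp: D_def left_diff_distrib fps_X_power_mult_nth)
    next
      case False
      then obtain m where m: "n = Suc (Suc m)" by (metis add_2_eq_Suc le_Suc_ex not_less)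
      have "D $ n - (q\<^sup>2) ^ n * D $ n = D $ m"
      proof (cases "even m")
        case True
        then obtain k where k: "m = 2 * k" by auto
        have "(q\<^sup>2) ^ n = (q ^ 4) ^ Suc k"
          unfolding power_mult[symmetric] by (rule arg_cong) (simp add: m k)
        moreover have "D $ n = e' (Suc k)" "D $ m = e' k" by (simp_all add: D_def m k)
        moreover have "e' (Suc k) - (q ^ 4) ^ Suc k * e' (Suc k) = e' k"
          using e'_Suc[of k] by (simp only: left_diff_distrib mult_1_left)
        ultimately show ?thesis by simp
      qed (simp add: D_def m)
      then show ?thesis by (simp add: left_diff_distrib fps_X_power_mult_nth m) (simp add: algebra_simps)
    qed
  qed
  have "C * D = A * B"
  proof (rule fps_dilate_equation_unique)
    show "(q\<^sup>2) ^ n \<noteq> 1" if "n > 0" for n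
      using q[of "2 * n"] that by (simp add: power_mult)
    show "(1 - fps_X\<^sup>2) * (C * D) = (1 + fps_const x * fps_X) * ?dil (C * D)"
      by (subst C) (simp add: fps_dilate_mult D mult_ac)
    \<comment> \<open>The factor 1 - t of 1 - t^2 is absorbed by \<open>A\<close>, the factor 1 + t
      by \<open>B\<close>.\<close>
    have "(1 - fps_X\<^sup>2) * (A * B) = ((1 - fps_X) * A) * ((1 + fps_X) * B)"
      by (simp add: algebra_simps power2_eq_square)
    also have "\<dots> = (1 + fps_const x * fps_X) * ?dil (A * B)"
      unfolding A[symmetric] B by (simp add: fps_dilate_mult mult_ac)
    finally show "(1 - fps_X\<^sup>2) * (A * B) = (1 + fps_const x * fps_X) * ?dil (A * B)" .
  qed (simp_all add: A_def B_def C_def D_def e0)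
  moreover have "(A * B) $ n = (\<Sum>(i, j) | i + j = n. e i * ((- 1) ^ j * qpoch x (q\<^sup>2) j * e j))"
  proof -
    have "(A * B) $ n = (\<Sum>i=0..n. e i * ((- 1) ^ (n - i) * qpoch x (q\<^sup>2) (n - i) * e (n - i)))"
      by (simp add: fps_mult_nth A_def B_def)
    also have "\<dots> = (\<Sum>(i, j) | i + j = n. e i * ((- 1) ^ j * qpoch x (q\<^sup>2) j * e j))"
      by (rule sum.reindex_bij_witness[where i = fst and j = "\<lambda>i. (i, n - i)"]) auto
    finally show ?thesis .
  qed
  moreover have "(C * D) $ n
      = (\<Sum>(i, j) | i + 2 * j = n. x ^ i * q ^ (i * (i - 1)) * e i * e' j)"
  proof -
    have "(C * D) $ n = (\<Sum>i=0..n. if even (n - i)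
        then x ^ i * q ^ (i * (i - 1)) * e i * e' ((n - i) div 2) else 0)"
      by (simp add: fps_mult_nth C_def D_def if_distrib cong: if_cong)
    also have "\<dots> = (\<Sum>i | i \<in> {0..n} \<and> even (n - i).
        x ^ i * q ^ (i * (i - 1)) * e i * e' ((n - i) div 2))"
      by (rule sum.inter_filter[symmetric]) simp
    also have "\<dots> = (\<Sum>(i, j) | i + 2 * j = n. x ^ i * q ^ (i * (i - 1)) * e i * e' j)"
      by (rule sum.reindex_bij_witness[where i = fst and j = "\<lambda>i. (i, (n - i) div 2)"]) auto
    finally show ?thesis .
  qed
  ultimately show ?thesis by simp
qed

section \<open>Summation of monomials and division by series free of the outer variable\<close>

lemma has_sum_fps_monomials:
  fixes g :: "'i \<Rightarrow> 'b::ring_1"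
  assumes "\<And>n. finite {p. w p = n}"
  shows "((\<lambda>p. fps_const (g p) * fps_X ^ w p) has_sum Abs_fps (\<lambda>n. \<Sum>p | w p = n. g p)) UNIV"
proof (rule has_sum_fpsI)
  let ?F = "\<lambda>p. fps_const (g p) * fps_X ^ w p"
  \<comment> \<open>Only the finite fibre of \<open>w\<close> over \<open>n\<close> contributes in
    degree \<open>n\<close>.\<close>
  have sub: "{p \<in> UNIV. ?F p $ n \<noteq> 0} \<subseteq> {p. w p = n}" for n
    by auto
  show "finite {p \<in> UNIV. ?F p $ n \<noteq> 0}" for n
    using sub assms by (rule finite_subset)
  have "(\<Sum>p | p \<in> UNIV \<and> ?F p $ n \<noteq> 0. ?F p $ n) = (\<Sum>p | w p = n. ?F p $ n)" for n
    by (rule sum.mono_neutral_left[OF assms sub]) auto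
  then show "Abs_fps (\<lambda>n. \<Sum>p | w p = n. g p) $ n = (\<Sum>p | p \<in> UNIV \<and> ?F p $ n \<noteq> 0. ?F p $ n)" for n
    by simp
qed

text \<open>Turns the denominators, which are free of \<open>y\<close>, into factors of the
  coefficient, so that each summand becomes a monomial in \<open>y\<close>.\<close>

lemma fps3_divide_fps_const:
  fixes f :: "'a::field fps3"
  assumes "d $ 0 $ 0 \<noteq> 0"
  shows "f / fps_const d = f * fps_const (inverse d)"
proof -
  have "inverse d * d = 1"
    using assms by (intro fps_inverse_mult_unit) simp
  then have "fps_const d * fps_const (inverse d) = 1"
    by (simp add: mult.commute)
  then have "f / fps_const d = f / fps_const d * fps_const d * fps_const (inverse d)"
    by (simp add: mult.assoc)
  also have "f / fps_const d * fps_const d = f"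
    using assms by (intro fps3_divide_mult_unit) simp
  finally show ?thesis .
qed

section \<open>The two double series, compared by powers of \<open>y\<close>\<close>

theorem theorem2p2:
  fixes x y q :: "'a::field fps3"
  defines "x \<equiv> var_x" and "y \<equiv> var_y" and "q \<equiv> var_q"
  defines "lhs \<equiv> \<lambda>i j. x ^ i * y ^ (i + 2 * j) * q ^ (2 * i\<^sup>2 + 4 * j\<^sup>2 + 4 * i * j - i)
                    / (qpoch (q\<^sup>2) (q\<^sup>2) i * qpoch (q ^ 4) (q ^ 4) j)"
  defines "rhs \<equiv> \<lambda>i j. (- 1) ^ j * qpoch x (q\<^sup>2) j * y ^ (i + j) * q ^ (i\<^sup>2 + j\<^sup>2 + 2 * i * j)
                    / (qpoch (q\<^sup>2) (q\<^sup>2) i * qpoch (q\<^sup>2) (q\<^sup>2) j)"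
  shows "(\<lambda>(i, j). lhs i j) summable_on UNIV \<and> (\<lambda>(i, j). rhs i j) summable_on UNIV \<and>
         (\<Sum>\<^sub>\<infinity>(i, j)\<in>UNIV. lhs i j) = (\<Sum>\<^sub>\<infinity>(i, j)\<in>UNIV. rhs i j)"
proof -
  \<comment> \<open>\<open>s\<close> and \<open>X\<close> are \<open>q\<close> and \<open>x\<close>
    seen in the coefficient ring of \<open>y\<close>, an integral domain, where the coefficient
    identity is applied.\<close>
  define s :: "'a fps fps" where "s = fps_const fps_X"
  define X :: "'a fps fps" where "X = fps_X"
  define d where "d m n = qpoch (s ^ m) (s ^ m) n" for m n
  define e where "e m n = inverse (d m n)" for m n
  have q: "q = fps_const s" and x: "x = fps_const X" and y: "y = fps_X"
    by (simp_all add: q_def var_q_def s_def x_def var_x_def X_def y_def var_y_def)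
  have qpoch_q: "qpoch (q ^ m) (q ^ m) n = fps_const (d m n)" for m n
    by (simp add: q d_def qpoch_fps_const fps_const_power)
  have d0: "d m n $ 0 $ 0 = 1" if "m > 0" for m n
    using qpoch_var_q_nth_0[OF that, of n, where ?'a = 'a] qpoch_q[of m n] by (simp add: q_def)
  have ed: "e m n * d m n = 1" if "m > 0" for m n
    unfolding e_def using d0[OF that, of n] by (intro fps_inverse_mult_unit) simp
  \<comment> \<open>Both sides are inverses of the same nonzero element of an integral domain, so
    that element can be cancelled.\<close>
  have inv_mult: "inverse (d m i * d l j) = e m i * e l j" if "m > 0" "l > 0" for m l i j
  proof -
    have "inverse (d m i * d l j) * (d m i * d l j) = 1"
      using d0[OF that(1), of i] d0[OF that(2), of j] by (intro fps_inverse_mult_unit) simp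
    moreover have "(e m i * e l j) * (d m i * d l j) = (e m i * d m i) * (e l j * d l j)"
      by (simp only: mult_ac)
    moreover have "d m i * d l j \<noteq> 0"
      using ed[OF that(1), of i] ed[OF that(2), of j] by auto
    ultimately show ?thesis
      using that by (metis ed mult.right_neutral mult_right_cancel)
  qed
  have divide: "f / (qpoch (q ^ m) (q ^ m) i * qpoch (q ^ l) (q ^ l) j) = f * fps_const (e m i * e l j)"
    if "m > 0" "l > 0" for f m l i j
    using d0[OF that(1), of i] d0[OF that(2), of j]
    by (simp add: qpoch_q fps3_divide_fps_const inv_mult that)
  define L where "L = (\<lambda>(i, j). s ^ (i + 2 * j)\<^sup>2 * (X ^ i * s ^ (i * (i - 1)) * e 2 i * e 4 j))"
  define R where "R = (\<lambda>(i, j). s ^ (i + j)\<^sup>2 * (e 2 i * ((- 1) ^ j * qpoch X (s\<^sup>2) j * e 2 j)))"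
  have lhs: "(\<lambda>(i, j). lhs i j) = (\<lambda>p. fps_const (L p) * fps_X ^ (case p of (i, j) \<Rightarrow> i + 2 * j))"
  proof (clarsimp simp: fun_eq_iff)
    fix i j :: nat
    have "2 * i\<^sup>2 + 4 * j\<^sup>2 + 4 * i * j - i = (i + 2 * j)\<^sup>2 + i * (i - 1)"
      by (cases i) (simp_all add: power2_eq_square algebra_simps)
    then show "lhs i j = fps_const (L (i, j)) * fps_X ^ (i + 2 * j)"
      unfolding lhs_def L_def
      by (simp add: divide power_add x y) (simp add: q fps_const_power mult_ac flip: fps_const_mult)
  qed
  have rhs: "(\<lambda>(i, j). rhs i j) = (\<lambda>p. fps_const (R p) * fps_X ^ (case p of (i, j) \<Rightarrow> i + j))"
  proof (clarsimp simp: fun_eq_iff)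
    fix i j :: nat
    have exp: "i\<^sup>2 + j\<^sup>2 + 2 * i * j = (i + j)\<^sup>2"
      by (simp add: power2_eq_square algebra_simps)
    have "qpoch x (q\<^sup>2) j = fps_const (qpoch X (s\<^sup>2) j)"
      by (simp add: x q fps_const_power qpoch_fps_const)
    moreover have "(- 1) ^ j = fps_const ((- 1) ^ j :: 'a fps fps)"
      by (subst fps_const_power[symmetric], subst fps_const_neg[symmetric]) simp
    ultimately show "rhs i j = fps_const (R (i, j)) * fps_X ^ (i + j)"
      unfolding rhs_def R_def exp
      by (simp add: divide y) (simp add: q fps_const_power mult_ac flip: fps_const_mult)
  qed
  have finite: "finite {p. (case p of (i, j) \<Rightarrow> i + k * j) = n}" if "k > 0" for k n :: nat
  proof (rule finite_subset)
    have "j \<le> i + k * j" for i j using that by (simp add: trans_le_add2)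
    then show "{p. (case p of (i, j) \<Rightarrow> i + k * j) = n} \<subseteq> {..n} \<times> {..n}"
      by auto
  qed simp
  have LR: "(\<Sum>p | (case p of (i, j) \<Rightarrow> i + 2 * j) = n. L p) =
      (\<Sum>p | (case p of (i, j) \<Rightarrow> i + j) = n. R p)" for n
  proof -
    \<comment> \<open>A positive power of \<open>s\<close> has constant coefficient 0.\<close>
    have "s ^ n \<noteq> 1" if "n > 0" for n
    proof
      assume "s ^ n = 1"
      then have "(s ^ n) $ 0 $ 0 = 1" by simp
      then show False using that by (simp add: s_def fps_const_power fps_power_zeroth zero_power)
    qed
    then have "(\<Sum>(i, j) | i + 2 * j = n. X ^ i * s ^ (i * (i - 1)) * e 2 i * e 4 j) =
        (\<Sum>(i, j) | i + j = n. e 2 i * ((- 1) ^ j * qpoch X (s\<^sup>2) j * e 2 j))"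
      using ed by (intro qseries_coefficient_identity) (simp_all add: d_def)
    moreover have "(\<Sum>p | (case p of (i, j) \<Rightarrow> i + 2 * j) = n. L p)
        = s ^ n\<^sup>2 * (\<Sum>(i, j) | i + 2 * j = n. X ^ i * s ^ (i * (i - 1)) * e 2 i * e 4 j)"
      unfolding sum_distrib_left by (rule sum.cong) (auto simp: L_def)
    moreover have "(\<Sum>p | (case p of (i, j) \<Rightarrow> i + j) = n. R p)
        = s ^ n\<^sup>2 * (\<Sum>(i, j) | i + j = n. e 2 i * ((- 1) ^ j * qpoch X (s\<^sup>2) j * e 2 j))"
      unfolding sum_distrib_left by (rule sum.cong) (auto simp: R_def)
    ultimately show ?thesis by simp
  qed
  have "((\<lambda>(i, j). lhs i j) has_sum
      Abs_fps (\<lambda>n. \<Sum>p | (case p of (i, j) \<Rightarrow> i + 2 * j) = n. L p)) UNIV"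
    unfolding lhs using finite[of 2] by (intro has_sum_fps_monomials) simp
  \<comment> \<open>The limit is written with \<open>L\<close> here too; \<open>LR\<close> turns it
    into the sums of \<open>R\<close>, and both families get literally the same sum.\<close>
  moreover have "((\<lambda>(i, j). rhs i j) has_sum
      Abs_fps (\<lambda>n. \<Sum>p | (case p of (i, j) \<Rightarrow> i + 2 * j) = n. L p)) UNIV"
    unfolding rhs LR using finite[of 1] by (intro has_sum_fps_monomials) simp
  ultimately show ?thesis
    by (metis has_sum_imp_summable infsumI)
qed

end
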